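(* Let $F:X\rightrightarrows Y$ be a $q$-srgi set-valued map with nonempty values that satisfies assumption $(A)$ and satisfies $q$-sgicc. If $F(X)$ is $P$-bounded, then $l\text{-}SWEff(F)$ is nonempty.
   Context: Standing setting: $X$ is a Hausdorff topological space; $Y$ is a Hausdorff (real) topological vector space; $P\subseteq Y$ is a closed convex cone which is solid ($\mathrm{int}\,P\neq\emptyset$) and proper ($\{0\}\neq P\neq Y$); $q\in\mathrm{int}\,P$ is fixed. Set-valued maps have nonempty values, and $F(X)=\bigcup_{x\in X}F(x)$. For nonempty $A,B\subseteq Y$: $A<^l B$ means $B\subseteq A+\mathrm{int}\,P$. For $B\subseteq Y$, $Colev_{<^l}(F,B):=\{x\in X: B\nless^l F(x)\}=\{x\in X: F(x)\not\subseteq B+\mathrm{int}\,P\}$; for $y\in Y$, $Colev_{<^l}(F,y):=Colev_{<^l}(F,\{y\})$. $l\text{-}SWEff(F)$ (strict weakly $l$-efficient solutions) is the set of $\bar x\in X$ such that there is no $x\in X$, $x\neq\bar x$, with $F(x)<^l F(\bar x)$. A nonempty set $A\subseteq Y$ is $P$-bounded if for each neighborhood $U$ of zero in $Y$ there is $r>0$ with $A\subseteq rU+P$. $\psi^q_P:Y\to\mathbb{R}$ is $\psi^q_P(y):=\sup\{t\in\mathbb{R}: y\in tq+P\}$. Assumption $(A)$ on $F$: $\psi^q_P$ attains its infimum on $F(x)$ for every $x\in X$. $M_F^q:=\sup\{t\in\mathbb{R}: F(X)\subseteq tq+P\}$ with $\sup\emptyset=-\infty$. $F$ is $q$-srgi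 ($q$-regular-global-inf) if whenever $x_0\in (Colev_{<^l}(F,\lambda q))^c$ for some real $\lambda>M_F^q$, there exist a neighborhood $U$ of $x_0$ and a real $r>M_F^q$ such that $U\subseteq (Colev_{<^l}(F,rq))^c$ (complements in $X$). $F$ satisfies $q$-sgicc ($q$-global-inf-coercive-condition) if there exists a real $\lambda>M_F^q$ such that $Colev_{<^l}(F,\lambda q)$ is a relatively compact set. *)

theory Defs
  imports "HOL-Analysis.Analysis" "HOL-Library.Set_Algebras"
begin

text \<open>
  Real topological vector spaces: addition and scalar multiplication are jointly continuous.
  As in \<^class>\<open>topological_monoid_add\<close>, joint continuity is expressed by filters.
  Hausdorffness is not included; it is imposed by the sort \<^class>\<open>t2_space\<close>.
\<close>

class topological_real_vector = topological_ab_group_add + real_vector +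
  assumes tendsto_scaleR_Pair:
    "LIM x (nhds a \<times>\<^sub>F nhds b). fst x *\<^sub>R snd x :> nhds (a *\<^sub>R b)"

instance real_normed_vector \<subseteq> topological_real_vector
proof
  fix a :: real and b :: 'a
  show "LIM x (nhds a \<times>\<^sub>F nhds b). fst x *\<^sub>R snd x :> nhds (a *\<^sub>R b)"
    by (intro tendsto_scaleR filterlim_fst filterlim_snd)
qed

text \<open>
  Sums of sets are Minkowski sums, so \<open>{y} + P\<close> is the translate \<open>y + P\<close>.
  The space \<open>X\<close> is a type, and set-valued maps are functions into sets.
\<close>

definition lless ::
  "'y::topological_real_vector set \<Rightarrow> 'y set \<Rightarrow> 'y set \<Rightarrow> bool"
  where "lless P A B \<longleftrightarrow> B \<subseteq> A + interior P"

definition Colev ::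
  "'y::topological_real_vector set \<Rightarrow> ('x \<Rightarrow> 'y set) \<Rightarrow> 'y set \<Rightarrow> 'x set"
  where "Colev P F B = {x. \<not> lless P B (F x)}"

definition Colev_pt ::
  "'y::topological_real_vector set \<Rightarrow> ('x \<Rightarrow> 'y set) \<Rightarrow> 'y \<Rightarrow> 'x set"
  where "Colev_pt P F y = Colev P F {y}"

definition l_SWEff ::
  "'y::topological_real_vector set \<Rightarrow> ('x \<Rightarrow> 'y set) \<Rightarrow> 'x set"
  where "l_SWEff P F = {xbar. \<not> (\<exists>x. x \<noteq> xbar \<and> lless P (F x) (F xbar))}"

definition P_bounded ::
  "'y::topological_real_vector set \<Rightarrow> 'y set \<Rightarrow> bool"
  where "P_bounded P A \<longleftrightarrow>
    A \<noteq> {} \<and> (\<forall>U. 0 \<in> interior U \<longrightarrow> (\<exists>r>0. A \<subseteq> (\<lambda>u. r *\<^sub>R u) ` U + P))"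

text \<open>
  For a proper closed convex cone \<open>P\<close> and \<open>q\<close> in its interior, the set below is nonempty and
  bounded above for every \<open>y\<close>, so the supremum in the reals is the intended one.
\<close>

definition psi ::
  "'y::topological_real_vector set \<Rightarrow> 'y \<Rightarrow> 'y \<Rightarrow> real"
  where "psi P q y = Sup {t. y \<in> {t *\<^sub>R q} + P}"

definition assumption_A ::
  "'y::topological_real_vector set \<Rightarrow> 'y \<Rightarrow> ('x \<Rightarrow> 'y set) \<Rightarrow> bool"
  where "assumption_A P q F \<longleftrightarrow> (\<forall>x. \<exists>y\<in>F x. \<forall>z\<in>F x. psi P q y \<le> psi P q z)"

text \<open>The supremum is taken in the extended reals, where \<open>Sup {} = -\<infinity>\<close>.\<close>

definition M_inf ::
  "'y::topological_real_vector set \<Rightarrow> 'y \<Rightarrow> ('x \<Rightarrow> 'y set) \<Rightarrow> ereal"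
  where "M_inf P q F = Sup (ereal ` {t. (\<Union>x. F x) \<subseteq> {t *\<^sub>R q} + P})"

definition q_srgi ::
  "'y::topological_real_vector set \<Rightarrow> 'y \<Rightarrow> ('x::topological_space \<Rightarrow> 'y set) \<Rightarrow> bool"
  where "q_srgi P q F \<longleftrightarrow>
    (\<forall>x0. \<forall>lam::real. ereal lam > M_inf P q F \<and> x0 \<in> - Colev_pt P F (lam *\<^sub>R q) \<longrightarrow>
      (\<exists>U. \<exists>r::real. x0 \<in> interior U \<and> ereal r > M_inf P q F \<and>
        U \<subseteq> - Colev_pt P F (r *\<^sub>R q)))"

definition q_sgicc ::
  "'y::topological_real_vector set \<Rightarrow> 'y \<Rightarrow> ('x::topological_space \<Rightarrow> 'y set) \<Rightarrow> bool"
  where "q_sgicc P q F \<longleftrightarrow>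
    (\<exists>lam::real. ereal lam > M_inf P q F \<and> compact (closure (Colev_pt P F (lam *\<^sub>R q))))"

end

theory Submission
  imports Defs
begin

text \<open>
  Write \<open>\<phi> x\<close> for the minimum of \<open>psi P q\<close> over \<open>F x\<close>. Since \<open>t < psi P q y\<close> holds exactly if
  \<open>y \<in> t q + int P\<close>, the set \<open>Colev_pt P F (t *\<^sub>R q)\<close> is the sublevel set \<open>{\<phi> \<le> t}\<close>, and \<open>M_inf\<close> is
  \<open>inf \<phi>\<close>, which is finite because \<open>F(X)\<close> is \<open>P\<close>-bounded. If \<open>\<phi>\<close> did not attain its infimum,
  every point would have a neighbourhood on which \<open>\<phi>\<close> exceeds some \<open>r > inf \<phi>\<close>; finitely many of
  them cover a relatively compact sublevel set, so \<open>\<phi>\<close> would be bounded away from its infimum.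
  A minimiser of \<open>\<phi>\<close> is strictly weakly efficient because \<open>psi P q\<close> strictly increases along
  \<open>int P\<close>.
\<close>

section \<open>Scalar limits, translates and attainment of an infimum\<close>

lemma tendsto_scaleR_topological_real_vector:
  fixes g :: "'a \<Rightarrow> 'y::topological_real_vector"
  assumes "(f \<longlongrightarrow> a) A" "(g \<longlongrightarrow> b) A"
  shows "((\<lambda>x. f x *\<^sub>R g x) \<longlongrightarrow> a *\<^sub>R b) A"
  using filterlim_compose[OF tendsto_scaleR_Pair filterlim_Pair[OF assms]] by simp

lemma singleton_plus_iff: "y \<in> {a} + P \<longleftrightarrow> y - a \<in> P" for y :: "'y::ab_group_add"
proof
  assume "y - a \<in> P"
  then have "a + (y - a) \<in> {a} + P"
    by (intro set_plus_intro) auto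
  then show "y \<in> {a} + P" by simp
qed (auto elim!: set_plus_elim)

text \<open>The hypothesis \<open>away\<close> is weaker than lower semicontinuity: near
  \<open>x\<close> the bound \<open>r\<close> only has to exceed the infimum, not come close to
  \<open>\<phi> x\<close>.\<close>

lemma attains_Inf_if_locally_bounded_away:
  fixes \<phi> :: "'x::topological_space \<Rightarrow> real"
  assumes bdd: "bdd_below (range \<phi>)"
    and l: "Inf (range \<phi>) < l" "compact (closure {x. \<phi> x \<le> l})"
    and away: "\<And>x. Inf (range \<phi>) < \<phi> x \<Longrightarrow>
      \<exists>U r. x \<in> interior U \<and> Inf (range \<phi>) < r \<and> (\<forall>u\<in>U. r < \<phi> u)"
  shows "\<exists>x. \<phi> x = Inf (range \<phi>)"
proof (rule ccontr)
  let ?m = "Inf (range \<phi>)"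
  let ?K = "closure {x. \<phi> x \<le> l}"
  assume "\<nexists>x. \<phi> x = ?m"
  moreover have "?m \<le> \<phi> x" for x
    using bdd by (simp add: cInf_lower)
  ultimately have "?m < \<phi> x" for x
    by (metis order_le_less)
  then have "\<forall>x. \<exists>U r. x \<in> interior U \<and> ?m < r \<and> (\<forall>u\<in>U. r < \<phi> u)"
    using away by blast
  then obtain U r where U: "x \<in> interior (U x)" and r: "?m < r x"
    and Ur: "\<forall>u\<in>U x. r x < \<phi> u" for x
    by metis
  have "?K \<subseteq> (\<Union>x\<in>UNIV. interior (U x))"
    using U by blast
  then obtain D where D: "finite D" "?K \<subseteq> (\<Union>x\<in>D. interior (U x))"
    by (rule compactE_image[OF l(2) open_interior])
  \<comment> \<open>A uniform lower bound: values outside the sublevel set exceed \<open>l\<close>,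
    and the remaining points lie in some \<open>U d\<close>, where values exceed \<open>r d\<close>.
    Including \<open>l\<close> keeps the minimum meaningful for empty \<open>D\<close>.\<close>
  define s where "s = Min (insert l (r ` D))"
  have "?m < s"
    using D(1) l(1) r by (simp add: s_def)
  moreover have "s \<le> \<phi> x" for x
  proof (cases "\<phi> x \<le> l")
    case True
    then have "x \<in> ?K"
      by (intro subsetD[OF closure_subset]) simp
    then obtain d where "d \<in> D" "x \<in> interior (U d)"
      using D(2) by blast
    then have "d \<in> D" "x \<in> U d"
      using interior_subset[of "U d"] by auto
    then have "s \<le> r d" "r d < \<phi> x"
      using D(1) Ur by (auto simp: s_def)
    then show ?thesis by simp
  next
    case False
    moreover have "s \<le> l"
      using D(1) by (simp add: s_def)
    ultimately show ?thesis by simp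
  qed
  then have "s \<le> ?m"
    by (intro cInf_greatest) auto
  ultimately show False by simp
qed

section \<open>Interior of a proper closed convex cone\<close>

locale solid_closed_convex_cone =
  fixes P :: "'y::topological_real_vector set" and q :: 'y
  assumes cone: "convex_cone P" and closed: "closed P" and proper: "P \<noteq> UNIV"
    and q_interior: "q \<in> interior P"
begin

lemma add_mem: "x \<in> P \<Longrightarrow> y \<in> P \<Longrightarrow> x + y \<in> P"
  using cone by (simp add: convex_cone_add)

lemma scaleR_mem: "x \<in> P \<Longrightarrow> 0 \<le> c \<Longrightarrow> c *\<^sub>R x \<in> P"
  using cone by (simp add: convex_cone_scaleR)

text \<open>The translate of \<open>interior P\<close> by \<open>y\<close> is open and stays inside
  \<open>P\<close>, since \<open>P\<close> is closed under addition.\<close>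

lemma interior_add_mem:
  assumes "x \<in> interior P" "y \<in> P"
  shows "x + y \<in> interior P"
proof (rule interiorI)
  show "open ((\<lambda>z. z - y) -` interior P)"
    by (intro open_vimage continuous_intros) simp
  show "(\<lambda>z. z - y) -` interior P \<subseteq> P"
  proof
    fix z assume "z \<in> (\<lambda>z. z - y) -` interior P"
    then have "(z - y) + y \<in> P"
      using interior_subset[of P] assms(2) by (intro add_mem[of "z - y"]) auto
    then show "z \<in> P" by simp
  qed
qed (use assms in simp)

lemma interior_scaleR_mem:
  assumes "x \<in> interior P" "0 < c"
  shows "c *\<^sub>R x \<in> interior P"
proof (rule interiorI)
  have "continuous_on UNIV (\<lambda>z::'y. inverse c *\<^sub>R z)"
    by (auto simp: continuous_on_def
      intro!: tendsto_scaleR_topological_real_vector tendsto_const tendsto_ident_at)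
  then show "open ((\<lambda>z. inverse c *\<^sub>R z) -` interior P)"
    by (intro open_vimage) auto
  show "(\<lambda>z. inverse c *\<^sub>R z) -` interior P \<subseteq> P"
  proof
    fix z assume "z \<in> (\<lambda>z. inverse c *\<^sub>R z) -` interior P"
    then have "c *\<^sub>R (inverse c *\<^sub>R z) \<in> P"
      using interior_subset[of P] assms(2) by (intro scaleR_mem[of "inverse c *\<^sub>R z"]) auto
    then show "z \<in> P" using assms(2) by simp
  qed
qed (use assms in simp)

text \<open>Otherwise y / n would lie in \<open>P\<close> for large n, and scaling back would put
  every y in \<open>P\<close>.\<close>

lemma zero_notin_interior: "0 \<notin> interior P"
proof
  assume 0: "0 \<in> interior P"
  have "y \<in> P" for y
  proof -
    have "((\<lambda>n. inverse (real (Suc n)) *\<^sub>R y) \<longlongrightarrow> 0 *\<^sub>R y) sequentially"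
      by (intro tendsto_scaleR_topological_real_vector LIMSEQ_inverse_real_of_nat tendsto_const)
    then have "eventually (\<lambda>n. inverse (real (Suc n)) *\<^sub>R y \<in> interior P) sequentially"
      using 0 by (intro topological_tendstoD) auto
    then obtain n where "inverse (real (Suc n)) *\<^sub>R y \<in> P"
      using interior_subset[of P] by (auto simp: eventually_sequentially)
    then have "real (Suc n) *\<^sub>R inverse (real (Suc n)) *\<^sub>R y \<in> P"
      by (rule scaleR_mem) simp
    then show ?thesis by (simp del: of_nat_Suc)
  qed
  with proper show False by blast
qed

section \<open>The scalarization \<open>psi\<close> along \<open>q\<close>\<close>

lemma continuous_minus_scaleR: "continuous_on UNIV (\<lambda>t. y - t *\<^sub>R q)"
  by (auto simp: continuous_on_def
    intro!: tendsto_diff tendsto_scaleR_topological_real_vector tendsto_const tendsto_ident_at)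

text \<open>Since q + y / n tends to the interior point \<open>q\<close>, it lies in
  \<open>P\<close> for some n; multiplying by n gives y + n q in \<open>P\<close>. So the supremum
  in \<open>psi\<close> is over a nonempty set.\<close>

lemma ex_minus_scaleR_mem: "\<exists>t. y - t *\<^sub>R q \<in> P"
proof -
  have "((\<lambda>n. q + inverse (real (Suc n)) *\<^sub>R y) \<longlongrightarrow> q + 0 *\<^sub>R y) sequentially"
    by (intro tendsto_add tendsto_scaleR_topological_real_vector LIMSEQ_inverse_real_of_nat
      tendsto_const)
  then have "eventually (\<lambda>n. q + inverse (real (Suc n)) *\<^sub>R y \<in> interior P) sequentially"
    using q_interior by (intro topological_tendstoD) auto
  then obtain n where "q + inverse (real (Suc n)) *\<^sub>R y \<in> P"
    using interior_subset[of P] by (auto simp: eventually_sequentially)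
  then have "real (Suc n) *\<^sub>R (q + inverse (real (Suc n)) *\<^sub>R y) \<in> P"
    by (intro scaleR_mem) auto
  then have "y - (- real (Suc n)) *\<^sub>R q \<in> P"
    by (simp add: scaleR_add_right add.commute del: of_nat_Suc)
  then show ?thesis by blast
qed

lemma minus_scaleR_mem_mono:
  assumes "y - t *\<^sub>R q \<in> P" "s \<le> t"
  shows "y - s *\<^sub>R q \<in> P"
proof -
  have "(y - t *\<^sub>R q) + (t - s) *\<^sub>R q \<in> P"
    using assms q_interior interior_subset[of P] by (intro add_mem scaleR_mem) auto
  then show ?thesis by (simp add: scaleR_diff_left)
qed

text \<open>If y - n q were in \<open>P\<close> for all n, dividing by n and passing to the limit in
  the closed set \<open>P\<close> would put -q in \<open>P\<close>, making 0 = q + (-q) an interior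
  point.\<close>

lemma bdd_above_minus_scaleR_mem: "bdd_above {t. y - t *\<^sub>R q \<in> P}"
proof (rule ccontr)
  assume unb: "\<not> ?thesis"
  have mem: "y - t *\<^sub>R q \<in> P" for t
  proof -
    obtain s where "y - s *\<^sub>R q \<in> P" "t < s"
      using unb by (auto simp: bdd_above_def not_le)
    then show ?thesis
      using minus_scaleR_mem_mono less_imp_le by blast
  qed
  have "((\<lambda>n. inverse (real (Suc n)) *\<^sub>R y - q) \<longlongrightarrow> 0 *\<^sub>R y - q) sequentially"
    by (intro tendsto_diff tendsto_scaleR_topological_real_vector LIMSEQ_inverse_real_of_nat
      tendsto_const)
  moreover have "inverse (real (Suc n)) *\<^sub>R y - q \<in> P" for n
    using scaleR_mem[OF mem[of "real (Suc n)"], of "inverse (real (Suc n))"]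
    by (simp add: scaleR_diff_right del: of_nat_Suc)
  ultimately have "0 *\<^sub>R y - q \<in> P"
    by (intro Lim_in_closed_set[OF closed]) auto
  then have "q + - q \<in> interior P"
    using q_interior by (intro interior_add_mem) auto
  then show False
    using zero_notin_interior by simp
qed

text \<open>The set behind \<open>psi\<close> is a half-line that contains its endpoint: downward
  closed because \<open>q\<close> is in \<open>P\<close>, closed because \<open>P\<close>
  is.\<close>

lemma le_psi_iff: "t \<le> psi P q y \<longleftrightarrow> y - t *\<^sub>R q \<in> P"
proof
  let ?T = "{t. y - t *\<^sub>R q \<in> P}"
  have psi: "psi P q y = Sup ?T"
    by (simp add: psi_def singleton_plus_iff)
  show "t \<le> psi P q y" if "y - t *\<^sub>R q \<in> P"
    unfolding psi using that by (intro cSup_upper bdd_above_minus_scaleR_mem) simp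
  have "closed ((\<lambda>t. y - t *\<^sub>R q) -` P)"
    using closed continuous_minus_scaleR by (rule closed_vimage)
  then have "closed ?T"
    by (simp add: vimage_def)
  moreover have "?T \<noteq> {}"
    using ex_minus_scaleR_mem by simp
  ultimately have "Sup ?T \<in> ?T"
    by (intro closed_contains_Sup bdd_above_minus_scaleR_mem)
  then show "y - t *\<^sub>R q \<in> P" if "t \<le> psi P q y"
    using that minus_scaleR_mem_mono[of y "Sup ?T" t] by (simp add: psi)
qed

text \<open>Forward, y - t q is a positive multiple of \<open>q\<close> plus an element of
  \<open>P\<close>. Backward, openness leaves room to raise \<open>t\<close> by e / 2.\<close>

lemma less_psi_iff: "t < psi P q y \<longleftrightarrow> y - t *\<^sub>R q \<in> interior P"
proof
  assume less: "t < psi P q y"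
  then have "(psi P q y - t) *\<^sub>R q + (y - psi P q y *\<^sub>R q) \<in> interior P"
    using q_interior
    by (intro interior_add_mem interior_scaleR_mem) (auto simp flip: le_psi_iff)
  then show "y - t *\<^sub>R q \<in> interior P"
    by (simp add: scaleR_diff_left)
next
  let ?V = "(\<lambda>t. y - t *\<^sub>R q) -` interior P"
  assume "y - t *\<^sub>R q \<in> interior P"
  moreover have "open ?V"
    using continuous_minus_scaleR by (intro open_vimage) auto
  ultimately obtain e where "e > 0" "ball t e \<subseteq> ?V"
    by (auto elim: openE)
  moreover have "t + e / 2 \<in> ball t e"
    using \<open>e > 0\<close> by (simp add: dist_real_def)
  ultimately have "y - (t + e / 2) *\<^sub>R q \<in> interior P"
    by blast
  then have "t + e / 2 \<le> psi P q y"
    using interior_subset[of P] by (auto simp: le_psi_iff)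
  with \<open>e > 0\<close> show "t < psi P q y" by simp
qed

lemma psi_less_psi_add:
  assumes "p \<in> interior P"
  shows "psi P q z < psi P q (z + p)"
proof -
  have "p + (z - psi P q z *\<^sub>R q) \<in> interior P"
    using assms by (intro interior_add_mem) (auto simp flip: le_psi_iff)
  then show ?thesis by (simp add: less_psi_iff algebra_simps)
qed

lemma P_bounded_imp_psi_bdd_below:
  assumes "P_bounded P A"
  shows "bdd_below (psi P q ` A)"
proof -
  \<comment> \<open>The neighbourhood int P - q of zero is chosen so that r u + p + r q = r (u + q)
    + p lies in \<open>P\<close>, which makes -r a lower bound of \<open>psi\<close>.\<close>
  let ?U = "(\<lambda>u. u + q) -` interior P"
  have "open ?U"
    by (intro open_vimage continuous_intros) simp
  then have "0 \<in> interior ?U"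
    using q_interior by (simp add: interior_open)
  then obtain r where r: "r > 0" "A \<subseteq> (\<lambda>u. r *\<^sub>R u) ` ?U + P"
    using assms unfolding P_bounded_def by meson
  have "- r \<le> psi P q a" if "a \<in> A" for a
  proof -
    obtain u p where a: "a = r *\<^sub>R u + p" and u: "u + q \<in> interior P" and p: "p \<in> P"
      using subsetD[OF r(2) \<open>a \<in> A\<close>] by (auto elim!: set_plus_elim)
    have "r *\<^sub>R (u + q) + p \<in> P"
      using u p r(1) interior_subset[of P] by (intro add_mem[OF scaleR_mem]) auto
    then show ?thesis
      by (simp add: le_psi_iff a algebra_simps)
  qed
  then show ?thesis by (rule bdd_belowI2)
qed

end

section \<open>Strict weak efficiency of a minimiser\<close>

theorem proposition5p2:
  fixes P :: "'y::{topological_real_vector, t2_space} set"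
    and q :: 'y
    and F :: "'x::t2_space \<Rightarrow> 'y set"
  assumes "convex_cone P" and "closed P" and "interior P \<noteq> {}"
    and "P \<noteq> {0}" and "P \<noteq> UNIV"
    and "q \<in> interior P"
    and "\<And>x. F x \<noteq> {}"
    and "q_srgi P q F"
    and "assumption_A P q F"
    and "q_sgicc P q F"
    and "P_bounded P (\<Union>x. F x)"
  shows "l_SWEff P F \<noteq> {}"
proof -
  interpret solid_closed_convex_cone P q
    using assms by unfold_locales auto
  obtain y where y: "y x \<in> F x" and y_min: "\<And>z. z \<in> F x \<Longrightarrow> psi P q (y x) \<le> psi P q z" for x
    using \<open>assumption_A P q F\<close> unfolding assumption_A_def by metis
  define \<phi> where "\<phi> x = psi P q (y x)" for x
  let ?m = "Inf (range \<phi>)"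
  have "range \<phi> \<subseteq> psi P q ` (\<Union>x. F x)"
    using y by (auto simp: \<phi>_def)
  then have bdd: "bdd_below (range \<phi>)"
    by (rule bdd_below_mono[OF P_bounded_imp_psi_bdd_below[OF \<open>P_bounded P (\<Union>x. F x)\<close>]])
  then have m_le: "?m \<le> \<phi> x" for x
    by (simp add: cInf_lower)
  \<comment> \<open>The strict version relies on attainment: values all above \<open>t\<close> could
    still have infimum \<open>t\<close>.\<close>
  have le_iff: "(\<forall>z\<in>F x. t \<le> psi P q z) \<longleftrightarrow> t \<le> \<phi> x"
    and less_iff: "(\<forall>z\<in>F x. t < psi P q z) \<longleftrightarrow> t < \<phi> x" for x t
    unfolding \<phi>_def using y[of x] y_min[of _ x] by (metis order_trans, metis order_less_le_trans)
  have "F x \<subseteq> {t *\<^sub>R q} + P \<longleftrightarrow> (\<forall>z\<in>F x. t \<le> psi P q z)" for x t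
    by (simp add: subset_eq singleton_plus_iff le_psi_iff)
  then have F_subset_iff: "F x \<subseteq> {t *\<^sub>R q} + P \<longleftrightarrow> t \<le> \<phi> x" for x t
    by (simp only: le_iff)
  have "lless P {t *\<^sub>R q} (F x) \<longleftrightarrow> (\<forall>z\<in>F x. t < psi P q z)" for x t
    by (simp add: lless_def subset_eq singleton_plus_iff less_psi_iff)
  then have Colev: "Colev_pt P F (t *\<^sub>R q) = {x. \<phi> x \<le> t}" for t
    by (simp add: Colev_pt_def Colev_def less_iff not_less)
  \<comment> \<open>The admissible levels form a half-line with real endpoint, so the extended-real
    supremum is the infimum of \<open>\<phi>\<close>.\<close>
  have "{t. (\<Union>x. F x) \<subseteq> {t *\<^sub>R q} + P} = {t. \<forall>x. t \<le> \<phi> x}"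
    by (simp add: UN_subset_iff F_subset_iff)
  also have "\<dots> = {..?m}"
    by (auto intro: cInf_greatest order_trans[OF _ m_le])
  finally have M: "M_inf P q F = ereal ?m"
    unfolding M_inf_def by (auto intro!: Sup_eqI)
  obtain l where l: "?m < l" "compact (closure {x. \<phi> x \<le> l})"
    using \<open>q_sgicc P q F\<close> by (auto simp: q_sgicc_def M Colev)
  have away: "\<exists>U r. x \<in> interior U \<and> ?m < r \<and> (\<forall>u\<in>U. r < \<phi> u)" if x: "?m < \<phi> x" for x
  proof -
    \<comment> \<open>A level strictly between leaves \<open>x\<close> outside the sublevel set at
      \<open>t\<close> while staying above \<open>M_inf\<close>, as \<open>q_srgi\<close>
      demands.\<close>
    obtain t where t: "?m < t" "t < \<phi> x"
      using dense[OF x] by blast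
    have "ereal t > M_inf P q F \<and> x \<in> - Colev_pt P F (t *\<^sub>R q)"
      using t by (simp add: M Colev)
    then obtain U r where U: "x \<in> interior U" "ereal r > M_inf P q F"
      "U \<subseteq> - Colev_pt P F (r *\<^sub>R q)"
      using \<open>q_srgi P q F\<close> unfolding q_srgi_def by meson
    have "r < \<phi> u" if "u \<in> U" for u
      using U(3) that by (auto simp: Colev)
    with U(1,2) show ?thesis
      by (auto simp: M)
  qed
  obtain a where a: "\<phi> a = ?m"
    using attains_Inf_if_locally_bounded_away[OF bdd l away] by blast
  have "\<not> lless P (F x) (F a)" for x
  proof
    assume "lless P (F x) (F a)"
    \<comment> \<open>The minimiser \<open>y a\<close> of \<open>psi\<close> on \<open>F a\<close>
      dominates some \<open>z\<close> in \<open>F x\<close> by an interior vector, so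
      \<open>\<phi> x\<close> would drop below the infimum.\<close>
    then obtain z p where zp: "y a = z + p" "z \<in> F x" "p \<in> interior P"
      using y[of a] unfolding lless_def by (blast elim: set_plus_elim)
    then have "psi P q z < \<phi> a"
      using psi_less_psi_add by (simp add: \<phi>_def)
    moreover have "\<phi> x \<le> psi P q z"
      using y_min zp by (simp add: \<phi>_def)
    ultimately show False
      using m_le[of x] a by simp
  qed
  then show ?thesis
    by (auto simp: l_SWEff_def)
qed

end
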